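(* Let $\sigma:A\to A^+$ be a primitive substitution whose matrix $M$ has strictly positive entries, let $\theta_1$ be the Perron-Frobenius eigenvalue of $M$, and let $\theta_2$ be an eigenvalue of $M$ that is a Galois conjugate of $\theta_1$ over $\mathbb{Q}$, is real, and satisfies $1<\theta_2<\theta_1$. Let $\gamma$ be the eigenvector of $M$ for $\theta_2$ defined in the context. Then the prefix-suffix decomposition $(p_i,c_i,s_i)_{i\in\mathbb{N}}$ of any minimal point $x\in X_\sigma$ is ultimately periodic, i.e. there exist integers $p\geq 1$ and $q\ge0$ with $(p_{i+p},c_{i+p},s_{i+p})=(p_i,c_i,s_i)$ for all $i\ge q$.
   Context: $A$ is a finite alphabet, $A^*$ the set of finite words (including the empty word $\varepsilon$), $A^+=A^*\setminus\{\varepsilon\}$. A substitution $\sigma:A\to A^+$ extends by concatenation to words and to $A^{\mathbb{Z}}$ (with $\sigma(x)=\cdots\sigma(x_{-1}).\sigma(x_0)\sigma(x_1)\cdots$, the dot separating negative and non-negative coordinates). Its matrix is $M=(M_{ab})_{a,b\in A}$, $M_{ab}$ = number of occurrences of $b$ in $\sigma(a)$. $\sigma$ is primitive if for some $N$ every $\sigma^N(a)$ contains every letter. $X_\sigma\subseteq A^{\mathbb{Z}}$ is the set of $x$ all of whose finite subwords are subwords of some $\sigma^N(a)$, $N\in\mathbb{N}$, $a\in A$. $T$ is the shift, $(Tx)_i=x_{i+1}$. Let $\lambda=(\lambda(a))_{a\in A}$ be a strictly positive right eigenvector of $M$ for $\theta_1$, normalized so that its coordinates lie in $\mathbb{Q}[\theta_1]$;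 let $\eta:\mathbb{Q}[\theta_1]\to\mathbb{Q}[\theta_2]$ be the field homomorphism with $\eta(\theta_1)=\theta_2$, and $\gamma(a)=\eta(\lambda(a))$; then $M\gamma=\theta_2\gamma$. For $x\in X_\sigma$ put $\gamma_0(x)=0$, $\gamma_n(x)=\sum_{i=0}^{n-1}\gamma(x_i)$ for $n>0$, and $\gamma_n(x)=-\sum_{i=n}^{-1}\gamma(x_i)$ for $n<0$. The point $x$ is minimal if $\gamma_n(x)\ge0$ for all $n\in\mathbb{Z}$. Prefix-suffix decomposition: for $x\in X_\sigma$ it is the unique sequence $(p_i,c_i,s_i)_{i\in\mathbb{N}}\in(A^*\times A\times A^* )^{\mathbb{N}}$ obtained by successive desubstitution: there are points $y^{(i)}\in X_\sigma$ with $y^{(0)}=x$, $c_i=y^{(i)}_0$, $\sigma(c_{i+1})=p_ic_is_i$ and $y^{(i)}=T^{|p_i|}\sigma(y^{(i+1)})$ for all $i\geq 0$; thus $\cdots\sigma^2(p_2)\sigma(p_1)p_0.c_0s_0\sigma(s_1)\sigma^2(s_2)\cdots$ is the central part of $x$. *)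

theory Defs
  imports
    "HOL-Analysis.Analysis"
    "HOL-Library.Sublist"
    "HOL-Computational_Algebra.Polynomial_Factorial"
    "HOL-Algebra.Ring"
begin

definition substitution :: "('a::finite \<Rightarrow> 'a list) \<Rightarrow> bool" where
  "substitution \<sigma> \<longleftrightarrow> (\<forall>a. \<sigma> a \<noteq> [])"

definition subst_word :: "('a \<Rightarrow> 'a list) \<Rightarrow> 'a list \<Rightarrow> 'a list" where
  "subst_word \<sigma> w = concat (map \<sigma> w)"

(* For a substitution (no empty image), the words sigma(x_0 ... x_k) and sigma(x_k ... x_{-1}) have
   at least k + 1, respectively - k, letters, so they reach coordinate k.  Coordinates k < 0 are read
   backwards from the dot: coordinate -1 is the last letter of sigma(x_{-1}). *)
definition subst_biinf :: "('a \<Rightarrow> 'a list) \<Rightarrow> (int \<Rightarrow> 'a) \<Rightarrow> int \<Rightarrow> 'a" where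
  "subst_biinf \<sigma> x k =
     (if 0 \<le> k then subst_word \<sigma> (map x [0..k]) ! nat k
      else rev (subst_word \<sigma> (map x [k..-1])) ! nat (- k - 1))"

definition shift :: "(int \<Rightarrow> 'a) \<Rightarrow> int \<Rightarrow> 'a" where
  "shift x i = x (i + 1)"

definition subst_matrix :: "('a::finite \<Rightarrow> 'a list) \<Rightarrow> 'b::semiring_1 ^ 'a ^ 'a" where
  "subst_matrix \<sigma> = (\<chi> a b. of_nat (count_list (\<sigma> a) b))"

definition primitive_subst :: "('a::finite \<Rightarrow> 'a list) \<Rightarrow> bool" where
  "primitive_subst \<sigma> \<longleftrightarrow> (\<exists>N. \<forall>a b. b \<in> set ((subst_word \<sigma> ^^ N) [a]))"

definition subst_subshift :: "('a::finite \<Rightarrow> 'a list) \<Rightarrow> (int \<Rightarrow> 'a) set" where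
  "subst_subshift \<sigma> =
     {x. \<forall>i j. \<exists>N a. sublist (map x [i..j]) ((subst_word \<sigma> ^^ N) [a])}"

definition eigenvector_of :: "'b::field ^ 'n ^ 'n \<Rightarrow> 'b \<Rightarrow> 'b ^ 'n \<Rightarrow> bool" where
  "eigenvector_of M k v \<longleftrightarrow> v \<noteq> 0 \<and> M *v v = k *s v"

definition eigenvalue_of :: "'b::field ^ 'n ^ 'n \<Rightarrow> 'b \<Rightarrow> bool" where
  "eigenvalue_of M k \<longleftrightarrow> (\<exists>v. eigenvector_of M k v)"

(* The Perron-Frobenius eigenvalue of a nonnegative matrix: the spectral radius, as an eigenvalue.
   The spectrum has to be taken over the complex numbers. *)
definition perron_frobenius_eigenvalue :: "real ^ 'n ^ 'n \<Rightarrow> real \<Rightarrow> bool" where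
  "perron_frobenius_eigenvalue M \<theta> \<longleftrightarrow>
     eigenvalue_of M \<theta> \<and>
     (\<forall>z::complex. eigenvalue_of (\<chi> i j. complex_of_real (M $ i $ j)) z \<longrightarrow> cmod z \<le> \<theta>)"

definition galois_conjugate :: "real \<Rightarrow> real \<Rightarrow> bool" where
  "galois_conjugate \<alpha> \<beta> \<longleftrightarrow>
     (\<exists>p :: rat poly. irreducible p \<and>
        poly (map_poly of_rat p) \<alpha> = 0 \<and> poly (map_poly of_rat p) \<beta> = 0)"

definition rat_adjoin :: "real \<Rightarrow> real ring" where
  "rat_adjoin \<theta> =
     \<lparr>carrier = range (\<lambda>p :: rat poly. poly (map_poly of_rat p) \<theta>),
      monoid.mult = (*), one = 1, ring.zero = 0, add = (+)\<rparr>"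

definition birkhoff_sum :: "real ^ 'a \<Rightarrow> (int \<Rightarrow> 'a) \<Rightarrow> int \<Rightarrow> real" where
  "birkhoff_sum \<gamma> x n =
     (if 0 \<le> n then \<Sum>i\<in>{0..<n}. \<gamma> $ x i else - (\<Sum>i\<in>{n..<0}. \<gamma> $ x i))"

definition minimal_point :: "('a::finite \<Rightarrow> 'a list) \<Rightarrow> real ^ 'a \<Rightarrow> (int \<Rightarrow> 'a) \<Rightarrow> bool" where
  "minimal_point \<sigma> \<gamma> x \<longleftrightarrow> x \<in> subst_subshift \<sigma> \<and> (\<forall>n. 0 \<le> birkhoff_sum \<gamma> x n)"

definition prefix_suffix_decomp ::
  "('a::finite \<Rightarrow> 'a list) \<Rightarrow> (int \<Rightarrow> 'a) \<Rightarrow> (nat \<Rightarrow> 'a list \<times> 'a \<times> 'a list) \<Rightarrow> bool" where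
  "prefix_suffix_decomp \<sigma> x d \<longleftrightarrow>
     (\<exists>y. y 0 = x \<and> (\<forall>i. y i \<in> subst_subshift \<sigma>) \<and>
        (\<forall>i. case d i of (p, c, s) \<Rightarrow>
            c = y i 0 \<and>
            \<sigma> (fst (snd (d (Suc i)))) = p @ c # s \<and>
            y i = (shift ^^ length p) (subst_biinf \<sigma> (y (Suc i)))))"

end

theory Submission
  imports Defs "HOL-Computational_Algebra.Field_as_Ring"
begin

text \<open>
Write \<open>weight v w\<close> for the sum of the coordinates of \<open>v\<close> over the letters of a word \<open>w\<close>; for an
eigenvector with eigenvalue \<open>\<theta>\<close>, applying \<open>\<sigma>\<close> to \<open>w\<close> multiplies its weight by \<open>\<theta>\<close>. If
\<open>(p\<^sub>i, c\<^sub>i, s\<^sub>i)\<close> is the decomposition of the minimal point \<open>x\<close>, then coordinate 0 of \<open>x\<close> lies in a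
copy of \<open>\<sigma>\<^sup>n(c\<^sub>n)\<close>, preceded there by a word of \<open>\<gamma>\<close>-weight
\<open>V\<^sub>n = \<Sum>j<n. \<theta>\<^sub>2\<^sup>j weight \<gamma> p\<^sub>j\<close>, and minimality says that no position of that copy is
preceded by a word of smaller weight. So the decomposition solves an optimization problem with
horizon \<open>n\<close>: descend from \<open>c\<^sub>n\<close> through \<open>n\<close> levels, choosing at each letter \<open>a\<close> a factorization
\<open>\<sigma> a = p b s\<close>, and minimize the total weight of the prefixes.

Because \<open>\<theta>\<^sub>2 > 1\<close>, the problem with infinite horizon has a value \<open>u\<close>, the solution of
\<open>\<theta>\<^sub>2 u(a) = min (weight \<gamma> p + u(b))\<close> over the factorizations (\<open>optimal_value_exists\<close>). The excess
\<open>V\<^sub>n - \<theta>\<^sub>2\<^sup>n u(c\<^sub>n)\<close> is nonnegative, as no choices beat the optimum, and bounded above, by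
minimality of \<open>x\<close> and \<open>desubstitution_potential\<close>; yet it grows by \<open>\<theta>\<^sub>2\<^sup>n\<close> times the loss incurred at level \<open>n\<close>. There
are finitely many possible losses, so from some level on every choice made by the decomposition is
optimal for \<open>u\<close>.

If each letter had one optimal factorization, \<open>c\<^sub>n\<^sub>+\<^sub>1\<close> would now determine \<open>(p\<^sub>n, c\<^sub>n, s\<^sub>n)\<close>, and a
sequence in a finite set in which each term is a function of the next one is eventually periodic
(\<open>backward_orbit_eventually_periodic\<close>). Ties are resolved by the Galois conjugation
\<open>\<theta>\<^sub>2 \<mapsto> \<theta>\<^sub>1\<close>. Fix the optimal strategy that always takes the last optimal factorization. The values
of \<open>u\<close> lie in \<open>\<rat>(\<theta>\<^sub>2)\<close>, and the conjugate \<open>\<Lambda>\<close> satisfies the same equation along this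
strategy with \<open>\<theta>\<^sub>1\<close> and \<open>lam\<close> (\<open>conjugate_values_discounted_equation\<close>). As \<open>lam\<close> is positive,
\<open>\<Lambda>(a)\<close> is a position in the interval \<open>[0, lam(a)]\<close>. An equality of \<open>\<gamma>\<close>-values conjugates to an
equality of positions, so if the factorization chosen by the decomposition comes strictly before the
last optimal one, both describe the same position, which has to be the right end of the block of
\<open>c\<^sub>n\<close>: \<open>\<Lambda>(c\<^sub>n) = lam(c\<^sub>n)\<close>, and by conjugation \<open>u(c\<^sub>n) = \<gamma>(c\<^sub>n)\<close>. Minimality of \<open>x\<close> against
the position just after \<open>\<sigma>\<^sup>n(c\<^sub>n)\<close> then forces \<open>V\<^sub>n = \<theta>\<^sub>2\<^sup>n \<gamma>(c\<^sub>n)\<close>. Conjugating once more, a proper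
prefix of \<open>\<sigma>\<^sup>n(c\<^sub>n)\<close> would have the same \<open>lam\<close>-weight as the whole word, which is absurd.
\<close>

section \<open>Self-maps of a finite set\<close>

lemma funpow_eventually_periodic:
  fixes F :: "'a::finite \<Rightarrow> 'a"
  shows "\<exists>m k. 0 < k \<and> F ^^ (m + k) = F ^^ m"
proof -
  have "\<not> inj (\<lambda>n. F ^^ n)"
    using finite_imageD[of "\<lambda>n. F ^^ n" UNIV] by auto
  then obtain i j where "F ^^ i = F ^^ j" "i < j"
    by (metis injI linorder_neqE_nat)
  then have "0 < j - i \<and> F ^^ (i + (j - i)) = F ^^ i"
    by simp
  then show ?thesis by blast
qed

text \<open>If \<open>F\<^sup>m\<^sup>+\<^sup>k = F\<^sup>m\<close>, then \<open>c n = F\<^sup>m\<^sup>+\<^sup>k (c (n + m + k)) = F\<^sup>m (c (n + m + k)) = c (n + k)\<close>; the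
preperiod \<open>m\<close> is absorbed by going further back, so periodicity starts as soon as the relation does.\<close>

lemma backward_orbit_eventually_periodic:
  fixes F :: "'a::finite \<Rightarrow> 'a" and c :: "nat \<Rightarrow> 'a"
  assumes "\<And>n. N \<le> n \<Longrightarrow> c n = F (c (Suc n))"
  shows "\<exists>k>0. \<forall>n\<ge>N. c (n + k) = c n"
proof -
  have orbit: "c n = (F ^^ j) (c (n + j))" if "N \<le> n" for n j
  proof (induction j)
    case (Suc j)
    have "c (n + j) = F (c (n + Suc j))" using assms[of "n + j"] that by simp
    then show ?case using Suc by (simp add: funpow_swap1)
  qed simp
  obtain m k where k: "0 < k" "F ^^ (m + k) = F ^^ m"
    using funpow_eventually_periodic by blast
  have "c (n + k) = c n" if "N \<le> n" for n
    using orbit[of n "m + k"] orbit[of "n + k" m] that k(2) by (simp add: ac_simps)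
  then show ?thesis using k(1) by blast
qed

text \<open>A maximum principle, evaluated at a point where \<open>f\<close> is minimal. Applied to differences, it compares
solutions of discounted equations.\<close>

lemma nonneg_if_expanded_along_map:
  fixes f :: "'a::finite \<Rightarrow> real"
  assumes "1 < \<theta>" and expand: "\<And>a. f (F a) \<le> \<theta> * f a"
  shows "0 \<le> f a"
proof -
  obtain b where b: "\<And>a. f b \<le> f a"
    using ex_min_if_finite[of "range f"] by (auto simp: not_less)
  have "f b \<le> \<theta> * f b"
    using b[of "F b"] expand[of b] by linarith
  then have "0 \<le> (\<theta> - 1) * f b"
    by (simp add: algebra_simps)
  then have "0 \<le> f b"
    using assms(1) by (simp add: zero_le_mult_iff)
  then show ?thesis using b[of a] by linarith
qed

text \<open>The partial sum \<open>\<Sum>j<n. \<theta>\<^sup>n\<^sup>-\<^sup>1\<^sup>-\<^sup>j r (F\<^sup>j a)\<close>.\<close>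

primrec orbit_sum :: "('a \<Rightarrow> 'a) \<Rightarrow> ('a \<Rightarrow> real) \<Rightarrow> real \<Rightarrow> nat \<Rightarrow> 'a \<Rightarrow> real" where
  "orbit_sum F r \<theta> 0 a = 0"
| "orbit_sum F r \<theta> (Suc n) a = \<theta> * orbit_sum F r \<theta> n a + r ((F ^^ n) a)"

lemma orbit_sum_Suc_left:
  "orbit_sum F r \<theta> (Suc n) a = \<theta> ^ n * r a + orbit_sum F r \<theta> n (F a)"
proof (induction n)
  case (Suc n)
  have "orbit_sum F r \<theta> (Suc (Suc n)) a
      = \<theta> * orbit_sum F r \<theta> (Suc n) a + r ((F ^^ Suc n) a)"
    by simp
  then show ?case
    unfolding Suc by (simp add: algebra_simps funpow_swap1)
qed simp

lemma discounted_equation_iterate: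
  assumes "\<And>a. \<theta> * f a = r a + f (F a)"
  shows "\<theta> ^ n * f a = orbit_sum F r \<theta> n a + f ((F ^^ n) a)"
proof (induction n)
  case (Suc n)
  have "\<theta> ^ Suc n * f a = \<theta> * (\<theta> ^ n * f a)" by simp
  also have "\<dots> = \<theta> * orbit_sum F r \<theta> n a + \<theta> * f ((F ^^ n) a)"
    unfolding Suc by (simp add: algebra_simps)
  finally show ?case using assms[of "(F ^^ n) a"] by simp
qed simp

text \<open>The solution is the series \<open>\<Sum>j. r (F\<^sup>j a) / \<theta>\<^sup>j\<^sup>+\<^sup>1\<close>. As \<open>F\<^sup>m\<^sup>+\<^sup>k = F\<^sup>m\<close> for some \<open>m\<close> and \<open>k\<close>, it has
a closed form, rational in \<open>\<theta>\<close>; this is what makes its conjugate meaningful later.\<close>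

lemma discounted_equation_solvable:
  fixes F :: "'a::finite \<Rightarrow> 'a" and r :: "'a \<Rightarrow> real"
  assumes "1 < \<theta>"
  shows "\<exists>f. \<forall>a. \<theta> * f a = r a + f (F a)"
proof -
  obtain m k where k: "0 < k" "F ^^ (m + k) = F ^^ m"
    using funpow_eventually_periodic by blast
  let ?S = "orbit_sum F r \<theta>" and ?K = "\<theta> ^ (m + k) - \<theta> ^ m"
  have K: "?K > 0" using assms k(1) by (simp add: power_strict_increasing)
  define f where "f a = (?S (m + k) a - ?S m a) / ?K" for a
  have "\<theta> * f a = r a + f (F a)" for a
  proof -
    have "?K * (\<theta> * f a) = \<theta> * ?S (m + k) a - \<theta> * ?S m a"
      unfolding f_def using K by (simp add: field_simps)
    also have "\<dots> = ?S (Suc (m + k)) a - ?S (Suc m) a"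
      by (simp add: k(2))
    also have "\<dots> = ?K * r a + (?S (m + k) (F a) - ?S m (F a))"
      unfolding orbit_sum_Suc_left by (simp add: algebra_simps)
    also have "\<dots> = ?K * (r a + f (F a))"
      unfolding f_def using K by (simp add: field_simps)
    finally show ?thesis using K by simp
  qed
  then show ?thesis by blast
qed

text \<open>Policy iteration for a deterministic decision process: at state \<open>a\<close> an action \<open>i\<close> costs \<open>r a i\<close> and
leads to \<open>t a i\<close>. Among the finitely many stationary strategies choose one with the least total value.
If some action improved it at some state, switching to that action there would lower the value at
that state and raise it nowhere.\<close>

lemma optimal_value_exists:
  fixes A :: "'a::finite \<Rightarrow> 'b set" and r :: "'a \<Rightarrow> 'b \<Rightarrow> real" and t :: "'a \<Rightarrow> 'b \<Rightarrow> 'a"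
  assumes \<theta>: "1 < \<theta>"
    and A: "\<And>a. finite (A a)" "\<And>a. A a \<noteq> {}"
  shows "\<exists>u. \<forall>a. (\<forall>i\<in>A a. \<theta> * u a \<le> r a i + u (t a i)) \<and> (\<exists>i\<in>A a. \<theta> * u a = r a i + u (t a i))"
proof -
  define S where "S = PiE UNIV A"
  have fin: "finite S" unfolding S_def by (intro finite_PiE) (simp_all add: A)
  have ne: "S \<noteq> {}" unfolding S_def by (simp add: PiE_eq_empty_iff A)
  have "\<forall>\<phi>. \<exists>f. \<forall>a. \<theta> * f a = r a (\<phi> a) + f (t a (\<phi> a))"
    using discounted_equation_solvable[OF \<theta>, of "\<lambda>a. r a (\<phi> a)" "\<lambda>a. t a (\<phi> a)" for \<phi>] by blast
  then obtain val where val: "\<And>\<phi> a. \<theta> * val \<phi> a = r a (\<phi> a) + val \<phi> (t a (\<phi> a))"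
    by metis
  obtain \<phi> where \<phi>: "\<phi> \<in> S" and min: "\<And>\<psi>. \<psi> \<in> S \<Longrightarrow> (\<Sum>a\<in>UNIV. val \<phi> a) \<le> (\<Sum>a\<in>UNIV. val \<psi> a)"
    using ex_is_arg_min_if_finite[OF fin ne, of "\<lambda>\<psi>. \<Sum>a\<in>UNIV. val \<psi> a"]
    unfolding is_arg_min_linorder by blast
  have "\<theta> * val \<phi> a \<le> r a i + val \<phi> (t a i)" if i: "i \<in> A a" for a i
  proof (rule ccontr)
    assume better: "\<not> ?thesis"
    define \<psi> where "\<psi> = \<phi>(a := i)"
    have \<psi>: "\<psi> \<in> S" using \<phi> i unfolding S_def \<psi>_def by (auto simp: PiE_UNIV_domain)
    \<comment> \<open>\<open>?f\<close> satisfies the equation of \<open>\<psi>\<close> with zero cost, except for a strict gain at \<open>a\<close>.\<close>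
    let ?f = "\<lambda>b. val \<phi> b - val \<psi> b"
    have expand: "?f (t b (\<psi> b)) \<le> \<theta> * ?f b" for b
      using val[of \<phi> b] val[of \<psi> b] better
      by (cases "b = a") (auto simp: \<psi>_def right_diff_distrib)
    have nonneg: "0 \<le> ?f b" for b
      by (rule nonneg_if_expanded_along_map[OF \<theta>, of ?f "\<lambda>b. t b (\<psi> b)"]) (rule expand)
    have "0 < \<theta> * ?f a"
      using val[of \<psi> a] better nonneg[of "t a i"] by (simp add: \<psi>_def right_diff_distrib)
    then have "0 < ?f a" using \<theta> by (simp add: zero_less_mult_iff)
    then have "0 < (\<Sum>b\<in>UNIV. ?f b)"
      by (intro sum_pos2[of _ a]) (use nonneg in simp_all)
    then show False using min[OF \<psi>] by (simp add: sum_subtractf)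
  qed
  moreover have "\<exists>i\<in>A a. \<theta> * val \<phi> a = r a i + val \<phi> (t a i)" for a
    using \<phi> val[of \<phi> a] unfolding S_def by (auto simp: PiE_UNIV_domain)
  ultimately show ?thesis by blast
qed

section \<open>Conjugate values\<close>

definition rat_eval :: "rat poly \<Rightarrow> real \<Rightarrow> real" where
  "rat_eval P \<theta> = poly (map_poly of_rat P) \<theta>"

lemma rat_eval_0 [simp]: "rat_eval 0 \<theta> = 0"
  by (simp add: rat_eval_def)

lemma rat_eval_pCons [simp]: "rat_eval (pCons c P) \<theta> = of_rat c + \<theta> * rat_eval P \<theta>"
  by (simp add: rat_eval_def map_poly_pCons)

lemma rat_eval_1 [simp]: "rat_eval 1 \<theta> = 1"
  by (simp add: one_pCons)

lemma rat_eval_add [simp]: "rat_eval (P + Q) \<theta> = rat_eval P \<theta> + rat_eval Q \<theta>"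
  by (induction P Q rule: poly_induct2) (simp_all add: of_rat_add algebra_simps)

lemma rat_eval_smult [simp]: "rat_eval (smult c P) \<theta> = of_rat c * rat_eval P \<theta>"
  by (induction P) (simp_all add: of_rat_mult algebra_simps)

lemma rat_eval_mult [simp]: "rat_eval (P * Q) \<theta> = rat_eval P \<theta> * rat_eval Q \<theta>"
  by (induction P) (simp_all add: algebra_simps)

lemma rat_eval_diff [simp]: "rat_eval (P - Q) \<theta> = rat_eval P \<theta> - rat_eval Q \<theta>"
  using rat_eval_add[of "P - Q" Q \<theta>] by simp

text \<open>The common irreducible polynomial divides every rational polynomial vanishing at \<open>\<alpha>\<close>: otherwise
Bezout would express 1 as a combination of two polynomials vanishing there.\<close>

lemma rat_eval_eq_0_conjugate:
  assumes "galois_conjugate \<alpha> \<beta>" and "rat_eval P \<alpha> = 0"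
  shows "rat_eval P \<beta> = 0"
proof -
  obtain p where p: "irreducible p" "rat_eval p \<alpha> = 0" "rat_eval p \<beta> = 0"
    using assms(1) unfolding galois_conjugate_def rat_eval_def by blast
  have "p dvd P"
  proof (rule ccontr)
    assume "\<not> p dvd P"
    then have "coprime p P"
      using p(1) by (intro prime_elem_imp_coprime irreducible_imp_prime_elem) auto
    then obtain a b where "a * p + b * P = 1"
      using bezout_coefficients_fst_snd[of p P] by auto
    then have "rat_eval (a * p + b * P) \<alpha> = 1" by simp
    then show False using p(2) assms(2) by simp
  qed
  then show ?thesis using p(3) by (auto elim: dvdE)
qed

text \<open>The graph of the isomorphism from \<open>\<rat>(\<theta>)\<close> to \<open>\<rat>(\<theta>')\<close> that maps \<open>\<theta>\<close> to \<open>\<theta>'\<close>, for conjugate \<open>\<theta>\<close> and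
\<open>\<theta>'\<close>. A relation given by quotients of polynomials is compatible with the field operations by
construction; conjugacy enters when equations are transferred from one side to the other.\<close>

definition conjugate_values :: "real \<Rightarrow> real \<Rightarrow> real \<Rightarrow> real \<Rightarrow> bool" where
  "conjugate_values \<theta> \<theta>' z z' \<longleftrightarrow>
     (\<exists>P Q. rat_eval Q \<theta> \<noteq> 0 \<and> rat_eval Q \<theta>' \<noteq> 0 \<and>
        z = rat_eval P \<theta> / rat_eval Q \<theta> \<and> z' = rat_eval P \<theta>' / rat_eval Q \<theta>')"

lemma conjugate_values_rat_eval: "conjugate_values \<theta> \<theta>' (rat_eval P \<theta>) (rat_eval P \<theta>')"
  unfolding conjugate_values_def by (intro exI[of _ P] exI[of _ 1]) simp

lemma conjugate_values_0: "conjugate_values \<theta> \<theta>' 0 0"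
  using conjugate_values_rat_eval[of \<theta> \<theta>' 0] by simp

lemma conjugate_values_self: "conjugate_values \<theta> \<theta>' \<theta> \<theta>'"
  using conjugate_values_rat_eval[of \<theta> \<theta>' "[:0, 1:]"] by simp

lemma conjugate_values_add:
  assumes "conjugate_values \<theta> \<theta>' x x'" "conjugate_values \<theta> \<theta>' y y'"
  shows "conjugate_values \<theta> \<theta>' (x + y) (x' + y')"
proof -
  obtain P Q where PQ: "rat_eval Q \<theta> \<noteq> 0" "rat_eval Q \<theta>' \<noteq> 0"
      "x = rat_eval P \<theta> / rat_eval Q \<theta>" "x' = rat_eval P \<theta>' / rat_eval Q \<theta>'"
    using assms(1) unfolding conjugate_values_def by blast
  obtain R S where RS: "rat_eval S \<theta> \<noteq> 0" "rat_eval S \<theta>' \<noteq> 0"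
      "y = rat_eval R \<theta> / rat_eval S \<theta>" "y' = rat_eval R \<theta>' / rat_eval S \<theta>'"
    using assms(2) unfolding conjugate_values_def by blast
  show ?thesis
    unfolding conjugate_values_def
    by (intro exI[of _ "P * S + R * Q"] exI[of _ "Q * S"]) (simp add: PQ RS add_frac_eq)
qed

lemma conjugate_values_mult:
  assumes "conjugate_values \<theta> \<theta>' x x'" "conjugate_values \<theta> \<theta>' y y'"
  shows "conjugate_values \<theta> \<theta>' (x * y) (x' * y')"
proof -
  obtain P Q where PQ: "rat_eval Q \<theta> \<noteq> 0" "rat_eval Q \<theta>' \<noteq> 0"
      "x = rat_eval P \<theta> / rat_eval Q \<theta>" "x' = rat_eval P \<theta>' / rat_eval Q \<theta>'"
    using assms(1) unfolding conjugate_values_def by blast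
  obtain R S where RS: "rat_eval S \<theta> \<noteq> 0" "rat_eval S \<theta>' \<noteq> 0"
      "y = rat_eval R \<theta> / rat_eval S \<theta>" "y' = rat_eval R \<theta>' / rat_eval S \<theta>'"
    using assms(2) unfolding conjugate_values_def by blast
  show ?thesis
    unfolding conjugate_values_def
    by (intro exI[of _ "P * R"] exI[of _ "Q * S"]) (simp add: PQ RS)
qed

lemma conjugate_values_diff:
  assumes "conjugate_values \<theta> \<theta>' x x'" "conjugate_values \<theta> \<theta>' y y'"
  shows "conjugate_values \<theta> \<theta>' (x - y) (x' - y')"
  using conjugate_values_add[OF assms(1) conjugate_values_mult[OF
      conjugate_values_rat_eval[of \<theta> \<theta>' "[:-1:]"] assms(2)]]
  by simp

lemma conjugate_values_inverse:
  assumes "conjugate_values \<theta> \<theta>' x x'" "x \<noteq> 0" "x' \<noteq> 0"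
  shows "conjugate_values \<theta> \<theta>' (inverse x) (inverse x')"
proof -
  obtain P Q where PQ: "rat_eval Q \<theta> \<noteq> 0" "rat_eval Q \<theta>' \<noteq> 0"
      "x = rat_eval P \<theta> / rat_eval Q \<theta>" "x' = rat_eval P \<theta>' / rat_eval Q \<theta>'"
    using assms(1) unfolding conjugate_values_def by blast
  show ?thesis
    unfolding conjugate_values_def
    by (intro exI[of _ Q] exI[of _ P]) (use PQ assms(2,3) in auto)
qed

lemma conjugate_values_power:
  "conjugate_values \<theta> \<theta>' x x' \<Longrightarrow> conjugate_values \<theta> \<theta>' (x ^ n) (x' ^ n)"
  using conjugate_values_rat_eval[of \<theta> \<theta>' 1]
  by (induction n) (simp_all add: conjugate_values_mult)

lemma conjugate_values_sum:
  "(\<And>i. i \<in> I \<Longrightarrow> conjugate_values \<theta> \<theta>' (f i) (g i)) \<Longrightarrow> conjugate_values \<theta> \<theta>' (sum f I) (sum g I)"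
  by (induction I rule: infinite_finite_induct) (auto intro: conjugate_values_0 conjugate_values_add)

lemma conjugate_values_eq_0_iff:
  assumes "galois_conjugate \<theta> \<theta>'" "conjugate_values \<theta> \<theta>' z z'"
  shows "z = 0 \<longleftrightarrow> z' = 0"
proof -
  have "galois_conjugate \<theta>' \<theta>"
    using assms(1) unfolding galois_conjugate_def by blast
  then have iff: "rat_eval P \<theta> = 0 \<longleftrightarrow> rat_eval P \<theta>' = 0" for P
    using rat_eval_eq_0_conjugate[OF assms(1)] rat_eval_eq_0_conjugate[of \<theta>' \<theta> P] by iprover
  obtain P Q where "rat_eval Q \<theta> \<noteq> 0" "rat_eval Q \<theta>' \<noteq> 0"
      "z = rat_eval P \<theta> / rat_eval Q \<theta>" "z' = rat_eval P \<theta>' / rat_eval Q \<theta>'"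
    using assms(2) unfolding conjugate_values_def by blast
  then show ?thesis using iff[of P] by simp
qed

lemma conjugate_values_eq_iff:
  assumes "galois_conjugate \<theta> \<theta>'" "conjugate_values \<theta> \<theta>' x x'" "conjugate_values \<theta> \<theta>' y y'"
  shows "x = y \<longleftrightarrow> x' = y'"
  using conjugate_values_eq_0_iff[OF assms(1) conjugate_values_diff[OF assms(2,3)]] by simp

lemma conjugate_values_orbit_sum:
  assumes "\<And>a. conjugate_values \<theta> \<theta>' (r a) (r' a)"
  shows "conjugate_values \<theta> \<theta>' (orbit_sum F r \<theta> n a) (orbit_sum F r' \<theta>' n a)"
  by (induction n)
    (auto intro: conjugate_values_0 conjugate_values_add conjugate_values_mult
      conjugate_values_self assms)

text \<open>Both functions are given by the same rational expression, one in \<open>\<theta>\<close> and \<open>r\<close>, the other in \<open>\<theta>'\<close>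
and \<open>r'\<close>.\<close>

lemma conjugate_values_discounted_equation:
  fixes F :: "'a::finite \<Rightarrow> 'a"
  assumes \<theta>: "1 < \<theta>" "1 < \<theta>'"
    and r: "\<And>a. conjugate_values \<theta> \<theta>' (r a) (r' a)"
    and f: "\<And>a. \<theta> * f a = r a + f (F a)"
    and f': "\<And>a. \<theta>' * f' a = r' a + f' (F a)"
  shows "conjugate_values \<theta> \<theta>' (f a) (f' a)"
proof -
  obtain m k where k: "0 < k" "F ^^ (m + k) = F ^^ m"
    using funpow_eventually_periodic by blast
  have solution: "g a = inverse (\<alpha> ^ (m + k) - \<alpha> ^ m) * (orbit_sum F s \<alpha> (m + k) a - orbit_sum F s \<alpha> m a)"
    if "1 < \<alpha>" and g: "\<And>a. \<alpha> * g a = s a + g (F a)" for \<alpha> s and g :: "'a \<Rightarrow> real"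
  proof -
    have "(\<alpha> ^ (m + k) - \<alpha> ^ m) * g a = orbit_sum F s \<alpha> (m + k) a - orbit_sum F s \<alpha> m a"
      using discounted_equation_iterate[of \<alpha> g s F "m + k" a, OF g]
        discounted_equation_iterate[of \<alpha> g s F m a, OF g]
      by (simp add: k(2) left_diff_distrib)
    moreover have "\<alpha> ^ m < \<alpha> ^ (m + k)"
      using that(1) k(1) by (simp add: power_strict_increasing)
    ultimately show ?thesis
      by (simp add: field_simps)
  qed
  have "\<theta> ^ m < \<theta> ^ (m + k)" "\<theta>' ^ m < \<theta>' ^ (m + k)"
    using \<theta> k(1) by (simp_all add: power_strict_increasing)
  then show ?thesis
    unfolding solution[where g = f and s = r, OF \<theta>(1) f]
      solution[where g = f' and s = r', OF \<theta>(2) f']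
    by (intro conjugate_values_mult conjugate_values_inverse conjugate_values_diff
        conjugate_values_power conjugate_values_self conjugate_values_orbit_sum r) auto
qed

text \<open>A ring homomorphism fixes the rational numbers, so its values are determined by the image of \<open>\<theta>\<close>.\<close>

lemma conjugate_values_hom:
  assumes hom: "\<eta> \<in> ring_hom (rat_adjoin \<theta>) (rat_adjoin \<theta>')" and \<eta>: "\<eta> \<theta> = \<theta>'"
    and z: "z \<in> carrier (rat_adjoin \<theta>)"
  shows "conjugate_values \<theta> \<theta>' z (\<eta> z)"
proof -
  have carrier: "rat_eval P \<theta> \<in> carrier (rat_adjoin \<theta>)" for P
    by (simp add: rat_adjoin_def rat_eval_def)
  have add: "\<eta> (rat_eval P \<theta> + rat_eval Q \<theta>) = \<eta> (rat_eval P \<theta>) + \<eta> (rat_eval Q \<theta>)" for P Q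
    using ring_hom_add[OF hom carrier carrier] by (simp add: rat_adjoin_def)
  have mult: "\<eta> (rat_eval P \<theta> * rat_eval Q \<theta>) = \<eta> (rat_eval P \<theta>) * \<eta> (rat_eval Q \<theta>)" for P Q
    using ring_hom_mult[OF hom carrier carrier] by (simp add: rat_adjoin_def)
  have one: "\<eta> 1 = 1"
    using ring_hom_one[OF hom] by (simp add: rat_adjoin_def)
  have zero: "\<eta> 0 = 0"
    using add[of 0 0] by simp
  have nat: "\<eta> (of_nat n) = of_nat n" for n
    using add[of 1 "[:of_nat n:]" for n] by (induction n) (simp_all add: zero one)
  have int: "\<eta> (of_int i) = of_int i" for i
  proof (cases i rule: int_cases2)
    case (nonpos n)
    then show ?thesis using add[of "[:of_int i:]" "[:of_nat n:]"] by (simp add: nat zero of_rat_minus)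
  qed (simp add: nat)
  have rat: "\<eta> (of_rat q) = of_rat q" for q
  proof (cases q)
    case (Fract i j)
    have ij: "(of_rat q :: real) * of_int j = of_int i"
      using Fract by (simp add: of_rat_rat)
    then have "\<eta> (of_rat q) * of_int j = of_int i"
      using mult[of "[:q:]" "[:of_int j:]"] by (simp add: int)
    then show ?thesis using ij Fract(2) by (metis mult_cancel_right of_int_0_eq_iff less_irrefl)
  qed
  have "\<eta> (rat_eval P \<theta>) = rat_eval P \<theta>'" for P
  proof (induction P)
    case (pCons c P)
    have "\<eta> (rat_eval (pCons c P) \<theta>) = \<eta> (of_rat c) + \<eta> (\<theta> * rat_eval P \<theta>)"
      using add[of "[:c:]" "pCons 0 P"] by simp
    also have "\<eta> (\<theta> * rat_eval P \<theta>) = \<theta>' * \<eta> (rat_eval P \<theta>)"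
      using mult[of "[:0, 1:]" P] \<eta> by simp
    finally show ?case by (simp add: rat pCons)
  qed (simp add: zero)
  moreover obtain P where "z = rat_eval P \<theta>"
    using z by (auto simp: rat_adjoin_def rat_eval_def)
  ultimately show ?thesis using conjugate_values_rat_eval by metis
qed

section \<open>Weights of words and desubstitution\<close>

abbreviation weight :: "real ^ 'a \<Rightarrow> 'a list \<Rightarrow> real" where
  "weight v w \<equiv> sum_list (map (($) v) w)"

lemma weight_eq_sum_count: "weight v w = (\<Sum>b\<in>UNIV. of_nat (count_list w b) * v $ b)"
proof (induction w)
  case (Cons a w)
  have "(\<Sum>b\<in>UNIV. of_nat (count_list (a # w) b) * v $ b)
      = (\<Sum>b\<in>UNIV. (if a = b then v $ b else 0) + of_nat (count_list w b) * v $ b)"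
    by (intro sum.cong) (simp_all add: algebra_simps)
  then show ?case by (simp add: Cons sum.distrib)
qed simp

lemma eigenvector_iff_weight:
  "subst_matrix \<sigma> *v v = \<theta> *s v \<longleftrightarrow> (\<forall>a. weight v (\<sigma> a) = \<theta> * v $ a)"
  by (simp add: weight_eq_sum_count vec_eq_iff matrix_vector_mult_def subst_matrix_def)

lemma conjugate_values_weight:
  assumes "\<And>a. conjugate_values \<theta> \<theta>' (v $ a) (v' $ a)"
  shows "conjugate_values \<theta> \<theta>' (weight v w) (weight v' w)"
  by (induction w) (auto intro: conjugate_values_0 conjugate_values_add assms)

lemma birkhoff_sum_0 [simp]: "birkhoff_sum v x 0 = 0"
  by (simp add: birkhoff_sum_def)

lemma birkhoff_sum_step: "birkhoff_sum v x (n + 1) = birkhoff_sum v x n + v $ x n"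
proof (cases "0 \<le> n")
  case True
  then have "{0..<n + 1} = insert n {0..<n}" by auto
  then show ?thesis using True by (simp add: birkhoff_sum_def)
next
  case False
  then have "{n..<0} = insert n {n + 1..<0}" by auto
  then show ?thesis using False
    by (cases "n = -1") (simp_all add: birkhoff_sum_def)
qed

lemma funpow_shift: "(shift ^^ l) x k = x (k + int l)"
  by (induction l arbitrary: k) (simp_all add: shift_def ac_simps)

lemma birkhoff_sum_shift:
  "birkhoff_sum v ((shift ^^ l) x) k = birkhoff_sum v x (k + int l) - birkhoff_sum v x (int l)"
proof -
  have step: "birkhoff_sum v ((shift ^^ l) x) (k + 1) - birkhoff_sum v x (k + 1 + int l)
      = birkhoff_sum v ((shift ^^ l) x) k - birkhoff_sum v x (k + int l)" for k
    using birkhoff_sum_step[of v x "k + int l"] birkhoff_sum_step[of v "(shift ^^ l) x" k]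
    by (simp add: funpow_shift ac_simps)
  show ?thesis
  proof (induction k rule: int_induct[where k = 0])
    case (step1 k)
    then show ?case using step[of k] by linarith
  next
    case (step2 k)
    then show ?case using step[of "k - 1"] by simp
  qed simp
qed

lemma length_subst_word_ge:
  assumes "substitution \<sigma>"
  shows "length w \<le> length (subst_word \<sigma> w)"
proof (induction w)
  case (Cons a w)
  have "Suc 0 \<le> length (\<sigma> a)" using assms by (simp add: substitution_def Suc_le_eq)
  then show ?case using Cons by (simp add: subst_word_def)
qed simp

text \<open>The coordinate at which the copy of \<open>\<sigma> (x m)\<close> begins in the bi-infinite word \<open>\<sigma>(x)\<close>.\<close>

definition block_start :: "('a \<Rightarrow> 'a list) \<Rightarrow> (int \<Rightarrow> 'a) \<Rightarrow> int \<Rightarrow> int" where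
  "block_start \<sigma> x m =
     (if 0 \<le> m then int (length (subst_word \<sigma> (map x [0..m-1])))
      else - int (length (subst_word \<sigma> (map x [m..-1]))))"

lemma block_start_step: "block_start \<sigma> x (m + 1) = block_start \<sigma> x m + int (length (\<sigma> (x m)))"
proof (cases "0 \<le> m")
  case True
  then show ?thesis
    using upto_rec2[of 0 m] by (simp add: block_start_def subst_word_def)
next
  case False
  then show ?thesis
    using upto_rec1[of m "-1"] by (cases "m = -1") (simp_all add: block_start_def subst_word_def)
qed

lemma subst_biinf_block:
  assumes \<sigma>: "substitution \<sigma>" and i: "i < length (\<sigma> (x m))"
  shows "subst_biinf \<sigma> x (block_start \<sigma> x m + int i) = \<sigma> (x m) ! i"
proof (cases "0 \<le> m")
  case True
  let ?w = "subst_word \<sigma> (map x [0..m-1])" and ?k = "block_start \<sigma> x m + int i"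
  have k: "?k = int (length ?w + i)" using True by (simp add: block_start_def)
  have "m \<le> int (length ?w)"
    using length_subst_word_ge[OF \<sigma>, of "map x [0..m-1]"] True by simp
  then have "[0..?k] = [0..m-1] @ m # [m+1..?k]"
    using True k by (intro upto_split3) auto
  then have "subst_word \<sigma> (map x [0..?k]) = ?w @ \<sigma> (x m) @ subst_word \<sigma> (map x [m+1..?k])"
    by (simp add: subst_word_def)
  moreover have "nat ?k = length ?w + i" "0 \<le> ?k"
    using k by auto
  ultimately show ?thesis
    unfolding subst_biinf_def using i by (simp add: nth_append)
next
  case False
  let ?w = "subst_word \<sigma> (map x [m+1..-1])" and ?k = "block_start \<sigma> x m + int i"
  have "[m..-1] = m # [m+1..-1]" using False by (intro upto_rec1) auto
  then have k: "?k = int i - int (length (\<sigma> (x m))) - int (length ?w)"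
    using False by (simp add: block_start_def subst_word_def)
  have "- 1 - m \<le> int (length ?w)"
    using length_subst_word_ge[OF \<sigma>, of "map x [m+1..-1]"] False by simp
  then have "[?k..-1] = [?k..m-1] @ m # [m+1..-1]"
    using False k i by (intro upto_split3) auto
  then have "subst_word \<sigma> (map x [?k..-1]) = subst_word \<sigma> (map x [?k..m-1]) @ \<sigma> (x m) @ ?w"
    by (simp add: subst_word_def)
  moreover have "nat (- ?k - 1) = length ?w + (length (\<sigma> (x m)) - 1 - i)" "?k < 0"
    using k i by auto
  ultimately show ?thesis
    unfolding subst_biinf_def using i by (auto simp: nth_append rev_nth)
qed

lemma birkhoff_sum_subst_biinf:
  assumes \<sigma>: "substitution \<sigma>" and v: "\<And>a. weight v (\<sigma> a) = \<theta> * v $ a"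
    and i: "i \<le> length (\<sigma> (x m))"
  shows "birkhoff_sum v (subst_biinf \<sigma> x) (block_start \<sigma> x m + int i)
    = \<theta> * birkhoff_sum v x m + weight v (take i (\<sigma> (x m)))"
proof -
  let ?B = "birkhoff_sum v (subst_biinf \<sigma> x)"
  have within: "?B (block_start \<sigma> x m + int i) = ?B (block_start \<sigma> x m) + weight v (take i (\<sigma> (x m)))"
    if "i \<le> length (\<sigma> (x m))" for m i
    using that
  proof (induction i)
    case (Suc i)
    have "?B (block_start \<sigma> x m + int (Suc i)) = ?B (block_start \<sigma> x m + int i + 1)"
      by (simp add: ac_simps)
    also have "\<dots> = ?B (block_start \<sigma> x m + int i) + v $ (\<sigma> (x m) ! i)"
      using Suc.prems by (simp add: birkhoff_sum_step subst_biinf_block[OF \<sigma>])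
    finally show ?case using Suc by (simp add: take_Suc_conv_app_nth)
  qed simp
  have next_block: "?B (block_start \<sigma> x (m + 1)) = ?B (block_start \<sigma> x m) + \<theta> * v $ x m" for m
    using within[of "length (\<sigma> (x m))" m] by (simp add: block_start_step v)
  have "?B (block_start \<sigma> x m) = \<theta> * birkhoff_sum v x m" for m
  proof (induction m rule: int_induct[where k = 0])
    case base
    then show ?case by (simp add: block_start_def subst_word_def)
  next
    case (step1 m)
    then show ?case
      using next_block[of m] birkhoff_sum_step[of v x m] by (simp add: distrib_left)
  next
    case (step2 m)
    then show ?case
      using next_block[of "m - 1"] birkhoff_sum_step[of v x "m - 1"] by (simp add: algebra_simps)
  qed
  then show ?thesis using within[OF i] by simp
qed

lemma desubstitution_step:
  assumes \<sigma>: "substitution \<sigma>" and v: "\<And>a. weight v (\<sigma> a) = \<theta> * v $ a"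
    and y: "y = (shift ^^ l) (subst_biinf \<sigma> z)" and l: "l < length (\<sigma> (z 0))"
    and i: "i < length (\<sigma> (z m))"
  shows "\<exists>k. y k = \<sigma> (z m) ! i \<and>
    birkhoff_sum v y k = \<theta> * birkhoff_sum v z m + weight v (take i (\<sigma> (z m))) - weight v (take l (\<sigma> (z 0)))"
proof (intro exI conjI)
  let ?k = "block_start \<sigma> z m + int i - int l"
  show "y ?k = \<sigma> (z m) ! i"
    using subst_biinf_block[of \<sigma> i z m] \<sigma> i by (simp add: y funpow_shift)
  have "birkhoff_sum v (subst_biinf \<sigma> z) (int l) = weight v (take l (\<sigma> (z 0)))"
    using birkhoff_sum_subst_biinf[OF \<sigma> v, of l z 0] l
    by (simp add: block_start_def subst_word_def)
  then show "birkhoff_sum v y ?k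
      = \<theta> * birkhoff_sum v z m + weight v (take i (\<sigma> (z m))) - weight v (take l (\<sigma> (z 0)))"
    using birkhoff_sum_subst_biinf[OF \<sigma> v, of i z m] i by (simp add: y birkhoff_sum_shift)
qed

text \<open>Each position of \<open>y n\<close> opens onto positions of \<open>y 0\<close>, through \<open>n\<close> successive choices of a letter
inside the image of the previous letter. If the choices realize the equation for \<open>f\<close>, then the
potential, Birkhoff sum plus \<open>f\<close>, is multiplied by \<open>\<theta>\<close> at each level, up to the shift which
recentres \<open>\<sigma> (y (Suc i))\<close>. It is used with \<open>f = u\<close>, which follows optimal choices, and with
\<open>f = 0\<close>, which follows the first letters and so stays at the left end of a block.\<close>

lemma desubstitution_potential:
  fixes y :: "nat \<Rightarrow> int \<Rightarrow> 'a::finite"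
  assumes \<sigma>: "substitution \<sigma>" and v: "\<And>a. weight v (\<sigma> a) = \<theta> * v $ a"
    and y: "\<And>i. y i = (shift ^^ l i) (subst_biinf \<sigma> (y (Suc i)))"
    and l: "\<And>i. l i < length (\<sigma> (y (Suc i) 0))"
    and f: "\<And>a. \<exists>i<length (\<sigma> a). \<theta> * f a = weight v (take i (\<sigma> a)) + f (\<sigma> a ! i)"
  shows "\<exists>k. birkhoff_sum v (y 0) k + f (y 0 k)
    = \<theta> ^ n * (birkhoff_sum v (y n) m + f (y n m)) - (\<Sum>j<n. \<theta> ^ j * weight v (take (l j) (\<sigma> (y (Suc j) 0))))"
proof (induction n arbitrary: m)
  case (Suc n)
  obtain i where i: "i < length (\<sigma> (y (Suc n) m))"
      "\<theta> * f (y (Suc n) m) = weight v (take i (\<sigma> (y (Suc n) m))) + f (\<sigma> (y (Suc n) m) ! i)"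
    using f by blast
  obtain k' where k': "y n k' = \<sigma> (y (Suc n) m) ! i"
      "birkhoff_sum v (y n) k' = \<theta> * birkhoff_sum v (y (Suc n)) m
        + weight v (take i (\<sigma> (y (Suc n) m))) - weight v (take (l n) (\<sigma> (y (Suc n) 0)))"
    using desubstitution_step[OF \<sigma> v y l i(1)] by blast
  have "birkhoff_sum v (y n) k' + f (y n k')
      = \<theta> * (birkhoff_sum v (y (Suc n)) m + f (y (Suc n) m)) - weight v (take (l n) (\<sigma> (y (Suc n) 0)))"
    using i(2) k' by (simp add: algebra_simps)
  then have "\<theta> ^ Suc n * (birkhoff_sum v (y (Suc n)) m + f (y (Suc n) m))
      = \<theta> ^ n * (birkhoff_sum v (y n) k' + f (y n k')) + \<theta> ^ n * weight v (take (l n) (\<sigma> (y (Suc n) 0)))"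
    by (simp flip: distrib_left)
  then show ?case using Suc[of k'] by simp
qed auto

section \<open>Minimal points\<close>

theorem theorem15:
  fixes \<sigma> :: "'a::finite \<Rightarrow> 'a list"
    and \<theta>\<^sub>1 \<theta>\<^sub>2 :: real
    and lam \<gamma> :: "real ^ 'a"
    and \<eta> :: "real \<Rightarrow> real"
    and x :: "int \<Rightarrow> 'a"
    and d :: "nat \<Rightarrow> 'a list \<times> 'a \<times> 'a list"
  assumes "substitution \<sigma>"
    and "primitive_subst \<sigma>"
    and "\<And>a b. (subst_matrix \<sigma> :: real ^ 'a ^ 'a) $ a $ b > 0"
    and "perron_frobenius_eigenvalue (subst_matrix \<sigma>) \<theta>\<^sub>1"
    and "eigenvalue_of (subst_matrix \<sigma>) \<theta>\<^sub>2"
    and "galois_conjugate \<theta>\<^sub>1 \<theta>\<^sub>2"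
    and "1 < \<theta>\<^sub>2"
    and "\<theta>\<^sub>2 < \<theta>\<^sub>1"
    and "eigenvector_of (subst_matrix \<sigma>) \<theta>\<^sub>1 lam"
    and "\<And>a. lam $ a > 0"
    and "\<And>a. lam $ a \<in> carrier (rat_adjoin \<theta>\<^sub>1)"
    and "\<eta> \<in> ring_hom (rat_adjoin \<theta>\<^sub>1) (rat_adjoin \<theta>\<^sub>2)"
    and "\<eta> \<theta>\<^sub>1 = \<theta>\<^sub>2"
    and "\<gamma> = (\<chi> a. \<eta> (lam $ a))"
    and "minimal_point \<sigma> \<gamma> x"
    and "prefix_suffix_decomp \<sigma> x d"
  shows "\<exists>p q :: nat. p \<ge> 1 \<and> (\<forall>i\<ge>q. d (i + p) = d i)"
proof -
  note \<sigma> = assms(1) and galois = assms(6) and lam_pos = assms(10)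
  have \<theta>: "1 < \<theta>\<^sub>1" "1 < \<theta>\<^sub>2" using assms(7,8) by auto
  have \<sigma>_ne: "0 < length (\<sigma> a)" for a using \<sigma> by (simp add: substitution_def)
  have conj_coord: "conjugate_values \<theta>\<^sub>1 \<theta>\<^sub>2 (lam $ a) (\<gamma> $ a)" for a
    using conjugate_values_hom[OF assms(12,13) assms(11)] by (simp add: assms(14))
  note conj_weight = conjugate_values_weight[of \<theta>\<^sub>1 \<theta>\<^sub>2 lam \<gamma>, OF conj_coord]
  have lam: "weight lam (\<sigma> a) = \<theta>\<^sub>1 * lam $ a" for a
    using assms(9) by (simp add: eigenvector_of_def eigenvector_iff_weight)
  have \<gamma>: "weight \<gamma> (\<sigma> a) = \<theta>\<^sub>2 * \<gamma> $ a" for a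
    using conjugate_values_eq_iff[OF galois conj_weight
        conjugate_values_mult[OF conjugate_values_self conj_coord]] lam by blast
  have weight_lam_nonneg: "0 \<le> weight lam w" for w
    by (induction w) (auto intro: add_nonneg_nonneg less_imp_le lam_pos)

  obtain y where y0: "y 0 = x" and "\<forall>i. case d i of (p, c, s) \<Rightarrow>
      c = y i 0 \<and> \<sigma> (fst (snd (d (Suc i)))) = p @ c # s \<and>
      y i = (shift ^^ length p) (subst_biinf \<sigma> (y (Suc i)))"
    using assms(16) unfolding prefix_suffix_decomp_def by blast
  note decomp = this(2)
  define p where "p i = fst (d i)" for i
  define c where "c i = fst (snd (d i))" for i
  define s where "s i = snd (snd (d i))" for i
  define l where "l i = length (p i)" for i
  have c: "c i = y i 0" and \<sigma>_c: "\<sigma> (c (Suc i)) = p i @ c i # s i"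
    and y: "y i = (shift ^^ l i) (subst_biinf \<sigma> (y (Suc i)))" for i
    using spec[OF decomp, of i] by (auto simp: p_def c_def s_def l_def split: prod.splits)
  have l: "l i < length (\<sigma> (c (Suc i)))" "take (l i) (\<sigma> (c (Suc i))) = p i"
    "\<sigma> (c (Suc i)) ! l i = c i" "drop (Suc (l i)) (\<sigma> (c (Suc i))) = s i" for i
    by (simp_all add: \<sigma>_c l_def)
  have minimal: "0 \<le> birkhoff_sum \<gamma> x k" for k
    using assms(15) by (simp add: minimal_point_def)

  \<comment> \<open>The \<open>\<gamma>\<close>-weight of the part of \<open>\<sigma>\<^sup>n(c n)\<close> to the left of the origin of \<open>x\<close>.\<close>
  define V where "V n = (\<Sum>j<n. \<theta>\<^sub>2 ^ j * weight \<gamma> (p j))" for n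
  have potential: "\<exists>k. birkhoff_sum \<gamma> x k + f (x k) = \<theta>\<^sub>2 ^ n * (birkhoff_sum \<gamma> (y n) m + f (y n m)) - V n"
    if "\<And>a. \<exists>i<length (\<sigma> a). \<theta>\<^sub>2 * f a = weight \<gamma> (take i (\<sigma> a)) + f (\<sigma> a ! i)" for f n m
    using desubstitution_potential[of \<sigma> \<gamma> \<theta>\<^sub>2 y l f n m, OF \<sigma> \<gamma> y _ that] l(1,2)
    by (simp add: c V_def y0)

  obtain u where u_le: "\<And>a i. i < length (\<sigma> a) \<Longrightarrow> \<theta>\<^sub>2 * u a \<le> weight \<gamma> (take i (\<sigma> a)) + u (\<sigma> a ! i)"
    and u_attained: "\<And>a. \<exists>i<length (\<sigma> a). \<theta>\<^sub>2 * u a = weight \<gamma> (take i (\<sigma> a)) + u (\<sigma> a ! i)"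
    using optimal_value_exists[OF \<theta>(2), of "\<lambda>a. {..<length (\<sigma> a)}"
        "\<lambda>a i. weight \<gamma> (take i (\<sigma> a))" "\<lambda>a i. \<sigma> a ! i"] \<sigma>_ne
    by (simp add: lessThan_empty_iff) (auto simp: Bex_def)
  have u_nonpos: "u a \<le> 0" for a
    using nonneg_if_expanded_along_map[OF \<theta>(2), of "\<lambda>a. - u a" "\<lambda>a. \<sigma> a ! 0" a]
      u_le[OF \<sigma>_ne] by simp
  define C where "C = (\<Sum>a\<in>UNIV. \<bar>u a\<bar>)"
  have C: "- u a \<le> C" for a
    using member_le_sum[of a UNIV "\<lambda>a. \<bar>u a\<bar>"] by (simp add: C_def)

  \<comment> \<open>The loss, compared with the optimum, when letter \<open>i\<close> of \<open>\<sigma> a\<close> is chosen.\<close>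
  define slack where "slack a i = weight \<gamma> (take i (\<sigma> a)) + u (\<sigma> a ! i) - \<theta>\<^sub>2 * u a" for a i
  have slack_nonneg: "0 \<le> slack (c (Suc n)) (l n)" for n
    using u_le[OF l(1), of n] by (simp add: slack_def)
  have excess_step: "V (Suc n) - \<theta>\<^sub>2 ^ Suc n * u (c (Suc n))
      = V n - \<theta>\<^sub>2 ^ n * u (c n) + \<theta>\<^sub>2 ^ n * slack (c (Suc n)) (l n)" for n
    by (simp add: V_def slack_def l algebra_simps)
  have excess_nonneg: "0 \<le> V n - \<theta>\<^sub>2 ^ n * u (c n)" for n
  proof (induction n)
    case (Suc n)
    show ?case unfolding excess_step using Suc slack_nonneg[of n] \<theta>(2) by simp
  qed (simp add: V_def u_nonpos)
  \<comment> \<open>Following optimal choices down from \<open>c n\<close> leads to a position of \<open>x\<close> whose Birkhoff sum is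
    \<open>\<theta>\<^sub>2\<^sup>n u (c n) - V n\<close> up to an error of at most \<open>C\<close>, and minimality makes it nonnegative.\<close>
  have excess_le: "V n - \<theta>\<^sub>2 ^ n * u (c n) \<le> C" for n
  proof -
    obtain k where "birkhoff_sum \<gamma> x k + u (x k) = \<theta>\<^sub>2 ^ n * u (c n) - V n"
      using potential[of u n 0, OF u_attained] by (auto simp: c)
    then show ?thesis using minimal[of k] C[of "x k"] by linarith
  qed
  have slack_le: "slack (c (Suc n)) (l n) \<le> C * inverse \<theta>\<^sub>2 ^ n" for n
  proof -
    have "\<theta>\<^sub>2 ^ n * slack (c (Suc n)) (l n) \<le> C"
      using excess_le[of "Suc n"] excess_nonneg[of n] unfolding excess_step by linarith
    then show ?thesis using \<theta>(2) by (simp add: field_simps)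
  qed
  have "(\<lambda>n. C * inverse \<theta>\<^sub>2 ^ n) \<longlonglongrightarrow> C * 0"
    using \<theta>(2) by (intro tendsto_mult tendsto_const LIMSEQ_power_zero) (simp add: field_simps)
  then have "eventually (\<lambda>n. C * inverse \<theta>\<^sub>2 ^ n < \<epsilon>) sequentially" if "0 < \<epsilon>" for \<epsilon>
    using that by (simp add: order_tendsto_iff)
  \<comment> \<open>Only finitely many pairs \<open>(a, i)\<close> occur, so the positive losses are bounded away from zero.\<close>
  then have "eventually (\<lambda>n. \<forall>(a, i)\<in>(SIGMA a:UNIV. {..<length (\<sigma> a)}).
      0 < slack a i \<longrightarrow> C * inverse \<theta>\<^sub>2 ^ n < slack a i) sequentially"
    by (intro eventually_ball_finite) auto
  then obtain N where N: "\<And>n a i. N \<le> n \<Longrightarrow> i < length (\<sigma> a) \<Longrightarrow> 0 < slack a i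
      \<Longrightarrow> C * inverse \<theta>\<^sub>2 ^ n < slack a i"
    unfolding eventually_sequentially by blast
  have slack_0: "slack (c (Suc n)) (l n) = 0" if "N \<le> n" for n
    using N[OF that l(1), of n] slack_le[of n] slack_nonneg[of n] by linarith

  \<comment> \<open>Taking the last optimal letter, and not the first, matters: a tie then puts \<open>c n\<close> on the left, with
    the tie at the right end of its block, an end that the origin of \<open>x\<close> does not reach. Were \<open>c n\<close> on the
    right, the tie would be at the left end of its block, where the origin may well be.\<close>
  define last_opt where "last_opt a = Max {i. i < length (\<sigma> a) \<and> slack a i = 0}" for a
  have "{i. i < length (\<sigma> a) \<and> slack a i = 0} \<noteq> {}" for a
    using u_attained[of a] by (auto simp: slack_def)
  from Max_in[OF _ this] have last_opt: "last_opt a < length (\<sigma> a)" "slack a (last_opt a) = 0" for a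
    by (auto simp: last_opt_def)
  define F where "F a = \<sigma> a ! last_opt a" for a
  obtain \<Lambda> where \<Lambda>: "\<And>a. \<theta>\<^sub>1 * \<Lambda> a = weight lam (take (last_opt a) (\<sigma> a)) + \<Lambda> (F a)"
    using discounted_equation_solvable[OF \<theta>(1), of "\<lambda>a. weight lam (take (last_opt a) (\<sigma> a))" F]
    by blast
  have u: "\<theta>\<^sub>2 * u a = weight \<gamma> (take (last_opt a) (\<sigma> a)) + u (F a)" for a
    using last_opt(2)[of a] by (simp add: slack_def F_def)
  \<comment> \<open>The same strategy underlies both equations, although it is optimal only for \<open>\<gamma>\<close>.\<close>
  have conj_u: "conjugate_values \<theta>\<^sub>1 \<theta>\<^sub>2 (\<Lambda> a) (u a)" for a
    using conjugate_values_discounted_equation[where f = \<Lambda> and f' = u, OF \<theta> conj_weight \<Lambda> u] .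
  have \<Lambda>_nonneg: "0 \<le> \<Lambda> a" for a
    using \<Lambda> weight_lam_nonneg by (intro nonneg_if_expanded_along_map[OF \<theta>(1), of \<Lambda> F]) simp
  have \<Lambda>_le: "\<Lambda> a \<le> lam $ a" for a
  proof -
    have "\<theta>\<^sub>1 * (lam $ a - \<Lambda> a) \<ge> lam $ F a - \<Lambda> (F a)" for a
    proof -
      have "\<theta>\<^sub>1 * lam $ a = weight lam (take (last_opt a) (\<sigma> a)) + lam $ F a
          + weight lam (drop (Suc (last_opt a)) (\<sigma> a))"
        using id_take_nth_drop[OF last_opt(1), of a] lam[of a]
        by (metis F_def add.assoc list.simps(9) map_append sum_list.Cons sum_list.append)
      then show ?thesis
        using \<Lambda>[of a] weight_lam_nonneg[of "drop (Suc (last_opt a)) (\<sigma> a)"]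
        by (simp add: right_diff_distrib)
    qed
    then have "0 \<le> lam $ a - \<Lambda> a"
      by (rule nonneg_if_expanded_along_map[OF \<theta>(1)])
    then show ?thesis by simp
  qed

  \<comment> \<open>The origin of \<open>x\<close> lies strictly before the right end of \<open>\<sigma>\<^sup>n(c n)\<close>.\<close>
  have length_prefix: "(\<Sum>j<n. \<theta>\<^sub>1 ^ j * weight lam (p j)) < \<theta>\<^sub>1 ^ n * lam $ c n" for n
  proof (induction n)
    case (Suc n)
    have "\<theta>\<^sub>1 * lam $ c (Suc n) = weight lam (p n) + (lam $ c n + weight lam (s n))"
      using lam[of "c (Suc n)"] by (simp add: \<sigma>_c)
    then have "\<theta>\<^sub>1 ^ n * (\<theta>\<^sub>1 * lam $ c (Suc n))
        = \<theta>\<^sub>1 ^ n * weight lam (p n) + \<theta>\<^sub>1 ^ n * lam $ c n + \<theta>\<^sub>1 ^ n * weight lam (s n)"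
      by (simp only: distrib_left add.assoc)
    moreover have "0 \<le> \<theta>\<^sub>1 ^ n * weight lam (s n)"
      using \<theta>(1) weight_lam_nonneg by simp
    ultimately show ?case using Suc by (simp add: power_Suc2 mult.assoc del: power_Suc)
  qed (simp add: lam_pos)
  have not_right_end: "u (c n) \<noteq> \<gamma> $ c n" for n
  proof
    assume eq: "u (c n) = \<gamma> $ c n"
    \<comment> \<open>Position 1 of \<open>y n\<close> leads to the coordinate of \<open>x\<close> just after the block \<open>\<sigma>\<^sup>n(c n)\<close>.\<close>
    obtain k where "birkhoff_sum \<gamma> x k = \<theta>\<^sub>2 ^ n * birkhoff_sum \<gamma> (y n) 1 - V n"
      using potential[of "\<lambda>_. 0" n 1] \<sigma>_ne by (force intro: exI[of _ 0])
    moreover have "birkhoff_sum \<gamma> (y n) 1 = \<gamma> $ c n"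
      using birkhoff_sum_step[of \<gamma> "y n" 0] by (simp add: c)
    ultimately have "V n = \<theta>\<^sub>2 ^ n * \<gamma> $ c n"
      using minimal[of k] excess_nonneg[of n] eq by simp
    moreover have "conjugate_values \<theta>\<^sub>1 \<theta>\<^sub>2 (\<Sum>j<n. \<theta>\<^sub>1 ^ j * weight lam (p j)) (V n)"
      unfolding V_def
      by (intro conjugate_values_sum conjugate_values_mult conjugate_values_power
          conjugate_values_self conj_weight)
    moreover have "conjugate_values \<theta>\<^sub>1 \<theta>\<^sub>2 (\<theta>\<^sub>1 ^ n * lam $ c n) (\<theta>\<^sub>2 ^ n * \<gamma> $ c n)"
      by (intro conjugate_values_mult conjugate_values_power conjugate_values_self conj_coord)
    ultimately show False
      using conjugate_values_eq_iff[OF galois] length_prefix[of n] by fastforce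
  qed

  have l_eq: "l n = last_opt (c (Suc n))" if "N \<le> n" for n
  proof (rule ccontr)
    let ?a = "c (Suc n)"
    let ?i = "last_opt ?a"
    assume "l n \<noteq> ?i"
    moreover have "l n \<le> ?i"
      unfolding last_opt_def using l(1) slack_0[OF that] by (intro Max_ge) auto
    ultimately have "l n < ?i" by simp
    then obtain w where "take ?i (\<sigma> ?a) = p n @ c n # w"
      by (auto simp: \<sigma>_c l_def take_Cons')
    then have "weight lam (p n) + lam $ c n \<le> weight lam (take ?i (\<sigma> ?a))"
      using weight_lam_nonneg[of w] by simp
    moreover have "weight \<gamma> (p n) + u (c n) = weight \<gamma> (take ?i (\<sigma> ?a)) + u (F ?a)"
      using slack_0[OF that] u[of ?a] by (simp add: slack_def l)
    then have "weight lam (p n) + \<Lambda> (c n) = weight lam (take ?i (\<sigma> ?a)) + \<Lambda> (F ?a)"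
      using conjugate_values_eq_iff[OF galois conjugate_values_add[OF conj_weight conj_u]
          conjugate_values_add[OF conj_weight conj_u]] by blast
    ultimately have "\<Lambda> (c n) = lam $ c n"
      using \<Lambda>_nonneg[of "F ?a"] \<Lambda>_le[of "c n"] by linarith
    then show False
      using conjugate_values_eq_iff[OF galois conj_u conj_coord] not_right_end by blast
  qed
  have "c n = F (c (Suc n))" if "N \<le> n" for n
    using l(3)[of n] l_eq[OF that] by (simp add: F_def)
  then obtain k where k: "0 < k" "\<forall>n\<ge>N. c (n + k) = c n"
    using backward_orbit_eventually_periodic[of N c F] by blast
  have d: "d n = (take (last_opt (c (Suc n))) (\<sigma> (c (Suc n))), c n, drop (Suc (last_opt (c (Suc n)))) (\<sigma> (c (Suc n))))"
    if "N \<le> n" for n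
    using l(2,4)[of n] l_eq[OF that] by (simp add: p_def c_def s_def prod_eq_iff)
  have "d (n + k) = d n" if "N \<le> n" for n
    using k(2)[rule_format, of "Suc n"] k(2)[rule_format, of n] that by (simp add: d)
  then show ?thesis using k(1) by (intro exI[of _ k] exI[of _ N]) simp
qed

end
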